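(* Let $(X,T)$ be a weakly mixing minimal system and let $p_1,\ldots,p_d\in\mathcal{P}_0^*$ be distinct polynomials. Then there is a dense $G_\delta$ subset $X_0$ of $X$ such that for any $x\in X_0$ the set $$\{(T^{p_1(n)}x,\ldots,T^{p_d(n)}x): n\in\mathbb{Z}\}$$ is dense in $X^d$.
   Context: A system $(X,T)$ consists of a compact metric space $X$ and a homeomorphism $T:X\to X$, viewed as a $\mathbb{Z}$-action. It is minimal if $X$ contains no proper non-empty closed $T$-invariant subset; it is transitive if every non-empty invariant open subset is dense; it is weakly mixing if $(X\times X,T\times T)$ is transitive. $\mathcal{P}_0^*$ is the set of non-constant polynomials $p$ with rational coefficients taking integer values on the integers and with $p(0)=0$. *)

theory Defs
  imports "HOL-Analysis.Analysis" "HOL-Computational_Algebra.Polynomial"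
begin

text \<open>
  The phase space is a type; a homeomorphism of it is regarded as an action of the integers, so
  a set \<open>A\<close> is invariant when \<open>T ` A = A\<close>, which for a bijection is invariance under both \<open>T\<close> and
  its inverse.
\<close>

definition invariant_set :: "('a \<Rightarrow> 'a) \<Rightarrow> 'a set \<Rightarrow> bool" where
  "invariant_set T A \<longleftrightarrow> T ` A = A"

definition minimal_system :: "('a::topological_space \<Rightarrow> 'a) \<Rightarrow> bool" where
  "minimal_system T \<longleftrightarrow>
    \<not> (\<exists>A. closed A \<and> invariant_set T A \<and> A \<noteq> {} \<and> A \<noteq> UNIV)"

definition transitive_system :: "('a::topological_space \<Rightarrow> 'a) \<Rightarrow> bool" where
  "transitive_system T \<longleftrightarrow>
    (\<forall>U. open U \<and> invariant_set T U \<and> U \<noteq> {} \<longrightarrow> closure U = UNIV)"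

definition weakly_mixing_system :: "('a::topological_space \<Rightarrow> 'a) \<Rightarrow> bool" where
  "weakly_mixing_system T \<longleftrightarrow> transitive_system (map_prod T T)"

text \<open>The iterate \<open>T\<^sup>n\<close> for an integer \<open>n\<close>; meaningful only for bijective \<open>T\<close>.\<close>

definition int_iterate :: "('a \<Rightarrow> 'a) \<Rightarrow> int \<Rightarrow> 'a \<Rightarrow> 'a" where
  "int_iterate T n = (if n \<ge> 0 then T ^^ nat n else inv T ^^ nat (- n))"

text \<open>\<open>P\<^sub>0\<^sup>*\<close>: the non-constant integer-valued rational polynomials vanishing at 0.\<close>

definition P0_star :: "rat poly set" where
  "P0_star = {p. degree p > 0 \<and> (\<forall>n::int. poly p (of_int n) \<in> \<int>) \<and> poly p 0 = 0}"

text \<open>The value at \<open>n\<close> as an integer; the floor is exact on \<^const>\<open>P0_star\<close>.\<close>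

definition int_value :: "rat poly \<Rightarrow> int \<Rightarrow> int" where
  "int_value p n = \<lfloor>poly p (of_int n)\<rfloor>"

text \<open>
  \<open>X\<^sup>d\<close> with the product topology; its points are the functions on \<open>{1..d}\<close> that are
  \<^const>\<open>undefined\<close> elsewhere.
\<close>

definition power_space :: "nat \<Rightarrow> (nat \<Rightarrow> 'a::topological_space) topology" where
  "power_space d = product_topology (\<lambda>_. euclidean) {1..d}"

end

theory Submission imports Defs "HOL-Library.Multiset" begin

text \<open>
  By Baire's theorem it suffices that for nonempty open \<open>U, V\<^sub>1, \<dots>, V\<^sub>d\<close> some \<open>x \<in> U\<close> and some \<open>n\<close> satisfy
  \<open>T\<^bsup>p\<^sub>i(n)\<^esup> x \<in> V\<^sub>i\<close> for all \<open>i\<close>. This is proved by PET induction with a topological van der Corput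
  argument: by minimality finitely many translates of \<open>U\<close> cover \<open>X\<close>, so the condition \<open>x \<in> U\<close> can be
  traded for the same statement about the shifted polynomials \<open>p\<^sub>i(n + l)\<close> for several \<open>l\<close>. Subtracting
  one of least degree from all of these lowers the complexity of the family. The linear \<open>p\<^sub>i\<close>, which
  shifting does not separate, need one \<open>l\<close> that is a return time for all of them simultaneously;
  it exists because return times of a weakly mixing minimal system are thickly syndetic, and such
  sets are stable under finite intersections and dilations.
\<close>

section \<open>Thickly syndetic sets of integers\<close>

definition thickly_syndetic :: "int set \<Rightarrow> bool" where
  "thickly_syndetic S \<longleftrightarrow>
    (\<forall>L. \<exists>G. \<forall>x. \<exists>m. \<bar>m - x\<bar> \<le> G \<and> (\<forall>y. \<bar>y - m\<bar> \<le> L \<longrightarrow> y \<in> S))"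

lemma thickly_syndetic_UNIV: "thickly_syndetic UNIV"
  unfolding thickly_syndetic_def by (metis UNIV_I abs_zero diff_self order_refl)

text \<open>A block of radius \<open>L + G'\<close> in \<open>S\<close> has room for a whole block
  of radius \<open>L\<close> in \<open>S'\<close>, whose centre can be found at most
  \<open>G'\<close> away.\<close>

lemma thickly_syndetic_Int:
  assumes "thickly_syndetic S" "thickly_syndetic S'"
  shows "thickly_syndetic (S \<inter> S')"
  unfolding thickly_syndetic_def
proof
  fix L
  obtain G' where G': "\<And>x. \<exists>m. \<bar>m - x\<bar> \<le> G' \<and> (\<forall>y. \<bar>y - m\<bar> \<le> L \<longrightarrow> y \<in> S')"
    using assms(2) unfolding thickly_syndetic_def by blast
  obtain G where G: "\<And>x. \<exists>m. \<bar>m - x\<bar> \<le> G \<and> (\<forall>y. \<bar>y - m\<bar> \<le> L + G' \<longrightarrow> y \<in> S)"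
    using assms(1) unfolding thickly_syndetic_def by blast
  show "\<exists>G. \<forall>x. \<exists>m. \<bar>m - x\<bar> \<le> G \<and> (\<forall>y. \<bar>y - m\<bar> \<le> L \<longrightarrow> y \<in> S \<inter> S')"
  proof (rule exI, rule allI)
    fix x
    obtain m where m: "\<bar>m - x\<bar> \<le> G" "\<forall>y. \<bar>y - m\<bar> \<le> L + G' \<longrightarrow> y \<in> S"
      using G by blast
    obtain m' where m': "\<bar>m' - m\<bar> \<le> G'" "\<forall>y. \<bar>y - m'\<bar> \<le> L \<longrightarrow> y \<in> S'"
      using G' by blast
    have "\<bar>m' - x\<bar> \<le> G + G'" using m(1) m'(1) by linarith
    moreover have "y \<in> S \<inter> S'" if "\<bar>y - m'\<bar> \<le> L" for y
    proof -
      have "\<bar>y - m\<bar> \<le> L + G'" using that m'(1) by linarith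
      then show ?thesis using that m m' by blast
    qed
    ultimately show "\<exists>m. \<bar>m - x\<bar> \<le> G + G' \<and> (\<forall>y. \<bar>y - m\<bar> \<le> L \<longrightarrow> y \<in> S \<inter> S')" by blast
  qed
qed

lemma thickly_syndetic_INT:
  assumes "finite I" "\<And>i. i \<in> I \<Longrightarrow> thickly_syndetic (S i)"
  shows "thickly_syndetic (\<Inter>i\<in>I. S i)"
  using assms by (induction rule: finite_induct) (auto intro: thickly_syndetic_UNIV thickly_syndetic_Int)

text \<open>Rounding the centre of a block near \<open>a * x\<close> to a multiple of
  \<open>a\<close> moves it by less than \<open>\<bar>a\<bar>\<close>, whence the surplus in the
  radius; dividing by \<open>a\<close> then leaves a block of radius \<open>L\<close>.\<close>

lemma thickly_syndetic_dilation:
  assumes S: "thickly_syndetic S" and a: "a \<noteq> 0"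
  shows "thickly_syndetic {l. a * l \<in> S}"
  unfolding thickly_syndetic_def
proof
  fix L
  obtain G where G: "\<And>x. \<exists>m. \<bar>m - x\<bar> \<le> G \<and> (\<forall>y. \<bar>y - m\<bar> \<le> \<bar>a\<bar> * L + \<bar>a\<bar> \<longrightarrow> y \<in> S)"
    using S unfolding thickly_syndetic_def by blast
  show "\<exists>G. \<forall>x. \<exists>m. \<bar>m - x\<bar> \<le> G \<and> (\<forall>y. \<bar>y - m\<bar> \<le> L \<longrightarrow> y \<in> {l. a * l \<in> S})"
  proof (rule exI, rule allI)
    fix x
    obtain m where m: "\<bar>m - a * x\<bar> \<le> G" "\<forall>y. \<bar>y - m\<bar> \<le> \<bar>a\<bar> * L + \<bar>a\<bar> \<longrightarrow> y \<in> S"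
      using G by blast
    define l where "l = m div a"
    have l: "\<bar>a * l - m\<bar> < \<bar>a\<bar>"
      using abs_mod_less[OF a, of m] unfolding l_def
      by (simp add: minus_mod_eq_mult_div[symmetric])
    have "\<bar>l - x\<bar> \<le> \<bar>a\<bar> * \<bar>l - x\<bar>"
      using a mult_right_mono[of 1 "\<bar>a\<bar>" "\<bar>l - x\<bar>"] by simp
    also have "\<dots> = \<bar>a * l - a * x\<bar>"
      by (simp add: abs_mult[symmetric] right_diff_distrib)
    also have "\<dots> \<le> G + \<bar>a\<bar>" using l m(1) by linarith
    finally have "\<bar>l - x\<bar> \<le> G + \<bar>a\<bar>" .
    moreover have "a * y \<in> S" if "\<bar>y - l\<bar> \<le> L" for y
    proof -
      have "\<bar>a * y - a * l\<bar> = \<bar>a\<bar> * \<bar>y - l\<bar>"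
        by (simp add: abs_mult[symmetric] right_diff_distrib)
      also have "\<dots> \<le> \<bar>a\<bar> * L" using that by (simp add: mult_left_mono)
      finally have "\<bar>a * y - m\<bar> \<le> \<bar>a\<bar> * L + \<bar>a\<bar>" using l by linarith
      then show ?thesis using m(2) by blast
    qed
    ultimately show "\<exists>m. \<bar>m - x\<bar> \<le> G + \<bar>a\<bar> \<and> (\<forall>y. \<bar>y - m\<bar> \<le> L \<longrightarrow> y \<in> {l. a * l \<in> S})" by blast
  qed
qed

lemma thickly_syndetic_not_subset_finite:
  assumes "thickly_syndetic S" "finite E"
  shows "\<exists>l\<in>S. l \<notin> E"
proof -
  obtain G where G: "\<And>x. \<exists>m. \<bar>m - x\<bar> \<le> G \<and> (\<forall>y. \<bar>y - m\<bar> \<le> 0 \<longrightarrow> y \<in> S)"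
    using assms(1) unfolding thickly_syndetic_def by blast
  obtain K where K: "\<And>e. e \<in> E \<Longrightarrow> e \<le> K"
    using bdd_above_finite[OF assms(2)] by (auto simp: bdd_above_def)
  \<comment> \<open>Everything within distance \<open>G\<close> of \<open>K + G + 1\<close> exceeds
    the upper bound \<open>K\<close> of \<open>E\<close>.\<close>
  obtain m where m: "\<bar>m - (K + G + 1)\<bar> \<le> G" "\<forall>y. \<bar>y - m\<bar> \<le> 0 \<longrightarrow> y \<in> S"
    using G by blast
  have "m \<notin> E" using K m(1) by fastforce
  then show ?thesis using m(2) by auto
qed

section \<open>Return times in a weakly mixing minimal system\<close>

locale weakly_mixing_minimal =
  fixes T :: "'a::metric_space \<Rightarrow> 'a"
  assumes compact_space: "compact (UNIV :: 'a set)"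
    and homeo: "\<exists>S. homeomorphism UNIV UNIV T S"
    and minimal: "minimal_system T"
    and weakly_mixing: "weakly_mixing_system T"
begin

section \<open>Integer iterates and covers by translates\<close>

abbreviation it :: "int \<Rightarrow> 'a \<Rightarrow> 'a" where
  "it \<equiv> int_iterate T"

lemma bij_T: "bij T"
  using homeo unfolding homeomorphism_def by (metis bijI' UNIV_I surjD image_iff)

lemma it_0 [simp]: "it 0 x = x"
  by (simp add: int_iterate_def)

lemma it_plus1: "it (n + 1) x = T (it n x)"
proof (cases "n \<ge> 0")
  case True
  then have "nat (n + 1) = Suc (nat n)" by simp
  with True show ?thesis by (simp add: int_iterate_def)
next
  case False
  then have "nat (- n) = Suc (nat (- (n + 1)))" by simp
  moreover have "T (inv T y) = y" for y
    using bij_T by (simp add: bij_is_surj surj_f_inv_f)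
  ultimately show ?thesis using False by (auto simp: int_iterate_def)
qed

lemma it_add: "it (m + n) x = it m (it n x)"
proof (induction m rule: int_induct[where k = 0])
  case (step1 i)
  have "i + 1 + n = (i + n) + 1" by simp
  then show ?case using step1 by (simp only: it_plus1)
next
  case (step2 i)
  have "T (it (i - 1 + n) x) = it (i + n) x"
    using it_plus1[of "i - 1 + n" x] by (simp add: algebra_simps)
  also have "\<dots> = T (it (i - 1) (it n x))"
    using it_plus1[of "i - 1" "it n x"] step2(2) by simp
  finally show ?case using bij_T by (simp add: bij_is_inj inj_eq)
qed simp

lemma it_1: "it 1 = T"
  using it_plus1[of 0] by auto

lemma it_minus [simp]: "it (- n) (it n x) = x" "it n (it (- n) x) = x"
  by (simp_all flip: it_add)

lemma continuous_on_it: "continuous_on A (it n)"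
proof -
  obtain S where S: "homeomorphism UNIV UNIV T S" using homeo by blast
  then have "inv T = S"
    using bij_T by (intro ext inv_f_eq) (simp_all add: homeomorphism_def bij_is_inj)
  then have "continuous_on UNIV (inv T)" "continuous_on UNIV T"
    using S by (auto simp: homeomorphism_def)
  then have "continuous_on UNIV (T ^^ k)" "continuous_on UNIV (inv T ^^ k)" for k
    by (induction k) (auto intro: continuous_on_compose2)
  then have "continuous_on UNIV (it n)" by (simp add: int_iterate_def)
  then show ?thesis by (rule continuous_on_subset) simp
qed

lemma open_vimage_it: "open U \<Longrightarrow> open (it n -` U)"
  using continuous_on_it[of UNIV n] by (simp add: continuous_on_open_vimage)

lemma vimage_it_nonempty: "U \<noteq> {} \<Longrightarrow> it n -` U \<noteq> {}"
proof -
  assume "U \<noteq> {}"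
  then obtain x where "x \<in> U" by blast
  then have "it (- n) x \<in> it n -` U" by simp
  then show ?thesis by blast
qed

text \<open>The union of all translates of \<open>U\<close> is open and invariant, so by minimality
  its complement is empty; compactness leaves finitely many translates.\<close>

lemma finite_translates_cover:
  assumes U: "open U" "U \<noteq> {}"
  obtains F where "finite F" "\<And>x. \<exists>s\<in>F. it (- s) x \<in> U"
proof -
  define W where "W = (\<Union>s. it (- s) -` U)"
  have W_iff: "y \<in> W \<longleftrightarrow> (\<exists>s. it (- s) y \<in> U)" for y by (simp add: W_def)
  have "open W" unfolding W_def using U by (blast intro: open_vimage_it)
  then have "closed (- W)" by (rule closed_Compl)
  have shift: "it k y \<in> W" if "y \<in> W" for k y
  proof -
    obtain s where "it (- s) y \<in> U" using \<open>y \<in> W\<close> W_iff by blast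
    then have "it (- (s + k)) (it k y) \<in> U" by (simp flip: it_add)
    then show ?thesis using W_iff by blast
  qed
  have "T ` W = W"
  proof (intro equalityI subsetI)
    fix y assume "y \<in> T ` W"
    then show "y \<in> W" using shift[of _ 1] by (auto simp: it_1)
  next
    fix y assume "y \<in> W"
    then have "it (-1) y \<in> W" by (rule shift)
    moreover have "y = T (it (-1) y)" using it_minus(2)[of 1 y] by (simp add: it_1)
    ultimately show "y \<in> T ` W" by (rule rev_image_eqI)
  qed
  then have "T ` (- W) = - W" using bij_T by (simp add: bij_image_Compl_eq)
  moreover obtain u where "u \<in> U" using U by blast
  then have "u \<in> W" unfolding W_iff by (intro exI[of _ 0]) simp
  then have "- W \<noteq> UNIV" by blast
  ultimately have "- W = {}"
    using minimal \<open>closed (- W)\<close> unfolding minimal_system_def invariant_set_def by blast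
  then have "UNIV \<subseteq> (\<Union>s. it (- s) -` U)" unfolding W_def by blast
  then obtain F where F: "finite F" "UNIV \<subseteq> (\<Union>s\<in>F. it (- s) -` U)"
    using compactE_image[OF compact_space, of UNIV "\<lambda>s. it (- s) -` U"] open_vimage_it[OF U(1)]
    by metis
  have "\<exists>s\<in>F. it (- s) x \<in> U" for x using F(2) by auto
  with F(1) show thesis by (rule that)
qed

section \<open>Sets of return times\<close>

definition returns :: "'a set \<Rightarrow> 'a set \<Rightarrow> int set" where
  "returns U V = {n. \<exists>x\<in>U. it n x \<in> V}"

text \<open>The saturation \<open>W\<close> of \<open>U \<times> U'\<close> under
  \<open>T \<times> T\<close> is open and invariant, hence dense by weak mixing, and meets
  \<open>V \<times> V'\<close>. As \<open>W\<close> consists of preimages under \<open>it s\<close>,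
  the common return time is \<open>- s\<close>.\<close>

lemma returns_Int_nonempty:
  assumes U: "open U" "U \<noteq> {}" and V: "open V" "V \<noteq> {}"
    and U': "open U'" "U' \<noteq> {}" and V': "open V'" "V' \<noteq> {}"
  shows "returns U V \<inter> returns U' V' \<noteq> {}"
proof -
  define W where "W = (\<Union>s. it s -` U \<times> it s -` U')"
  have W_iff: "z \<in> W \<longleftrightarrow> (\<exists>s. it s (fst z) \<in> U \<and> it s (snd z) \<in> U')" for z
    by (auto simp: W_def mem_Times_iff)
  have "open W" unfolding W_def using U U' by (intro open_UN ballI open_Times open_vimage_it)
  have shift: "map_prod (it k) (it k) z \<in> W" if "z \<in> W" for k z
  proof -
    obtain s where "it s (fst z) \<in> U" "it s (snd z) \<in> U'" using \<open>z \<in> W\<close> W_iff by blast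
    then have "it (s - k) (it k (fst z)) \<in> U" "it (s - k) (it k (snd z)) \<in> U'"
      by (simp_all flip: it_add)
    then show ?thesis unfolding W_iff by auto
  qed
  have "map_prod T T ` W = W"
  proof (intro equalityI subsetI)
    fix z assume "z \<in> map_prod T T ` W"
    then show "z \<in> W" using shift[of _ 1] by (auto simp: it_1)
  next
    fix z assume "z \<in> W"
    then have "map_prod (it (-1)) (it (-1)) z \<in> W" by (rule shift)
    moreover have "z = map_prod T T (map_prod (it (-1)) (it (-1)) z)"
      using it_minus(2)[of 1] by (cases z) (simp add: it_1)
    ultimately show "z \<in> map_prod T T ` W" by (rule rev_image_eqI)
  qed
  moreover obtain u u' where "u \<in> U" "u' \<in> U'" using U U' by blast
  then have "(u, u') \<in> W" unfolding W_iff by (intro exI[of _ 0]) simp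
  ultimately have "closure W = UNIV"
    using weakly_mixing \<open>open W\<close>
    unfolding weakly_mixing_system_def transitive_system_def invariant_set_def by blast
  moreover have "open (V \<times> V')" using V V' by (simp add: open_Times)
  moreover have "V \<times> V' \<noteq> {}" using V V' by blast
  ultimately have "V \<times> V' \<inter> W \<noteq> {}"
    by (simp add: open_Int_closure_eq_empty[symmetric])
  then obtain z where "z \<in> W" "z \<in> V \<times> V'" by (meson IntE ex_in_conv)
  then obtain s where s: "it s (fst z) \<in> U" "it s (snd z) \<in> U'" "fst z \<in> V" "snd z \<in> V'"
    unfolding W_iff mem_Times_iff by blast
  from s(1,3) have "- s \<in> returns U V"
    unfolding returns_def by (intro CollectI bexI[of _ "it s (fst z)"]) simp_all
  moreover from s(2,4) have "- s \<in> returns U' V'"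
    unfolding returns_def by (intro CollectI bexI[of _ "it s (snd z)"]) simp_all
  ultimately show ?thesis by blast
qed

text \<open>Furstenberg's argument that the return time sets form a filter base. Take
  \<open>n\<close> a common return time from \<open>U\<close> to \<open>U'\<close> and from
  \<open>V\<close> to \<open>V'\<close>, and cut \<open>U\<close> and \<open>V\<close> down to the
  points that \<open>it n\<close> sends into \<open>U'\<close> and \<open>V'\<close>. Applying
  \<open>it n\<close> to a passage between the smaller sets gives one from \<open>U'\<close> to
  \<open>V'\<close>.\<close>

lemma returns_Int_returns:
  assumes "open U" "U \<noteq> {}" "open V" "V \<noteq> {}" "open U'" "U' \<noteq> {}" "open V'" "V' \<noteq> {}"
  obtains U'' V'' where "open U''" "U'' \<noteq> {}" "open V''" "V'' \<noteq> {}"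
    "returns U'' V'' \<subseteq> returns U V \<inter> returns U' V'"
proof -
  obtain n where n: "n \<in> returns U U'" "n \<in> returns V V'"
    using returns_Int_nonempty[of U U' V V'] assms by blast
  define U'' V'' where "U'' = U \<inter> it n -` U'" and "V'' = V \<inter> it n -` V'"
  show thesis
  proof (rule that[of U'' V''])
    show "open U''" "open V''" using assms by (auto simp: U''_def V''_def intro: open_vimage_it)
    show "U'' \<noteq> {}" "V'' \<noteq> {}" using n by (auto simp: U''_def V''_def returns_def)
    show "returns U'' V'' \<subseteq> returns U V \<inter> returns U' V'"
    proof
      fix m assume "m \<in> returns U'' V''"
      then obtain x where x: "x \<in> U''" "it m x \<in> V''" by (auto simp: returns_def)
      then have "it m (it n x) \<in> V'"
        by (simp add: V''_def add.commute flip: it_add)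
      with x show "m \<in> returns U V \<inter> returns U' V'"
        by (auto simp: returns_def U''_def V''_def)
    qed
  qed
qed

lemma returns_INT:
  assumes "finite I" "\<And>i. i \<in> I \<Longrightarrow> open (U i) \<and> U i \<noteq> {} \<and> open (V i) \<and> V i \<noteq> {}"
  shows "\<exists>U' V'. open U' \<and> U' \<noteq> {} \<and> open V' \<and> V' \<noteq> {} \<and> returns U' V' \<subseteq> (\<Inter>i\<in>I. returns (U i) (V i))"
  using assms
proof (induction rule: finite_induct)
  case empty
  show ?case by (rule exI[of _ UNIV], rule exI[of _ UNIV]) simp
next
  case (insert i I)
  then obtain U' V' where *: "open U'" "U' \<noteq> {}" "open V'" "V' \<noteq> {}"
    "returns U' V' \<subseteq> (\<Inter>i\<in>I. returns (U i) (V i))" by auto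
  obtain U'' V'' where "open U''" "U'' \<noteq> {}" "open V''" "V'' \<noteq> {}"
    "returns U'' V'' \<subseteq> returns (U i) (V i) \<inter> returns U' V'"
    using returns_Int_returns[of "U i" "V i" U' V'] insert.prems[of i] * by blast
  with * show ?case by (intro exI[of _ U''] exI[of _ V'']) auto
qed

text \<open>Some \<open>it (- s)\<close> with \<open>s\<close> in a finite set carries
  \<open>it (- x) v\<close> into \<open>U\<close>, and from there \<open>it (x + s)\<close> leads
  back to \<open>v\<close>; so a return time lies within a bounded distance of
  \<open>x\<close>.\<close>

lemma returns_syndetic:
  assumes U: "open U" "U \<noteq> {}" and V: "V \<noteq> {}"
  shows "\<exists>G. \<forall>x. \<exists>m\<in>returns U V. \<bar>m - x\<bar> \<le> G"
proof -
  obtain F where F: "finite F" "\<And>x. \<exists>s\<in>F. it (- s) x \<in> U"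
    using finite_translates_cover[OF U] by blast
  obtain v where v: "v \<in> V" using V by blast
  obtain K where K: "\<And>s. s \<in> abs ` F \<Longrightarrow> s \<le> K"
    using bdd_above_finite[of "abs ` F"] F(1) by (auto simp: bdd_above_def)
  show ?thesis
  proof (rule exI, rule allI)
    fix x
    obtain s where s: "s \<in> F" "it (- s) (it (- x) v) \<in> U" using F(2) by blast
    have "it (x + s) (it (- s) (it (- x) v)) = v" by (simp flip: it_add)
    then have "x + s \<in> returns U V" using s(2) v unfolding returns_def by force
    then show "\<exists>m\<in>returns U V. \<bar>m - x\<bar> \<le> K" using K s(1) by (intro bexI[of _ "x + s"]) auto
  qed
qed

text \<open>\<open>m + r\<close> is a return time to \<open>V\<close> exactly when \<open>m\<close>
  is one to the preimage of \<open>V\<close> under \<open>it r\<close>. A block around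
  \<open>m\<close> thus amounts to \<open>m\<close> lying in finitely many return time sets, and
  their intersection contains a syndetic one.\<close>

lemma thickly_syndetic_returns:
  assumes U: "open U" "U \<noteq> {}" and V: "open V" "V \<noteq> {}"
  shows "thickly_syndetic (returns U V)"
  unfolding thickly_syndetic_def
proof
  fix L :: int
  obtain U' V' where *: "open U'" "U' \<noteq> {}" "open V'" "V' \<noteq> {}"
    "returns U' V' \<subseteq> (\<Inter>r\<in>{-L..L}. returns U (it r -` V))"
    using returns_INT[of "{-L..L}" "\<lambda>_. U" "\<lambda>r. it r -` V"] U
      open_vimage_it[OF V(1)] vimage_it_nonempty[OF V(2)] by blast
  obtain G where G: "\<And>x. \<exists>m\<in>returns U' V'. \<bar>m - x\<bar> \<le> G"
    using returns_syndetic * by metis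
  show "\<exists>G. \<forall>x. \<exists>m. \<bar>m - x\<bar> \<le> G \<and> (\<forall>y. \<bar>y - m\<bar> \<le> L \<longrightarrow> y \<in> returns U V)"
  proof (rule exI, rule allI)
    fix x
    obtain m where m: "m \<in> returns U' V'" "\<bar>m - x\<bar> \<le> G" using G[of x] by blast
    have "y \<in> returns U V" if "\<bar>y - m\<bar> \<le> L" for y
    proof -
      have "m \<in> returns U (it (y - m) -` V)" using m(1) *(5) that by force
      then show ?thesis by (auto simp: returns_def simp flip: it_add)
    qed
    with m(2) show "\<exists>m. \<bar>m - x\<bar> \<le> G \<and> (\<forall>y. \<bar>y - m\<bar> \<le> L \<longrightarrow> y \<in> returns U V)" by blast
  qed
qed

end

section \<open>Integer-valued polynomials and the PET weight\<close>

definition int_valued :: "rat poly \<Rightarrow> bool" where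
  "int_valued p \<longleftrightarrow> (\<forall>n::int. poly p (of_int n) \<in> \<int>)"

lemma of_int_int_value: "int_valued p \<Longrightarrow> of_int (int_value p n) = poly p (of_int n)"
  unfolding int_valued_def int_value_def by (metis Ints_cases floor_of_int)

lemma int_valued_diff: "int_valued p \<Longrightarrow> int_valued q \<Longrightarrow> int_valued (p - q)"
  by (simp add: int_valued_def)

lemma int_value_diff:
  assumes "int_valued p" "int_valued q"
  shows "int_value (p - q) n = int_value p n - int_value q n"
proof -
  have "of_int (int_value (p - q) n) = (of_int (int_value p n - int_value q n) :: rat)"
    using assms by (simp add: of_int_int_value int_valued_diff)
  then show ?thesis by (simp only: of_int_eq_iff)
qed

lemma int_value_0 [simp]: "int_value 0 n = 0"
  by (simp add: int_value_def)

text \<open>The slope \<open>a\<close> is an integer, being a difference of two values of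
  \<open>p\<close>.\<close>

lemma linear_int_value:
  assumes p: "int_valued p" "degree p = 1"
  shows "\<exists>a. a \<noteq> 0 \<and> (\<forall>n m. int_value p (n + m) = int_value p n + a * m)"
proof -
  obtain c b where cb: "p = [:c, b:]" using p(2) degree1_coeffs[of p] by blast
  then have "b \<noteq> 0" using p(2) by auto
  define a where "a = int_value p 1 - int_value p 0"
  have b: "of_int a = b" using of_int_int_value[OF p(1)] cb by (simp add: a_def)
  have "int_value p (n + m) = int_value p n + a * m" for n m
  proof -
    have "(of_int (int_value p (n + m)) :: rat) = of_int (int_value p n + a * m)"
      by (simp add: of_int_int_value[OF p(1)] b) (simp add: cb algebra_simps)
    then show ?thesis by (simp only: of_int_eq_iff)
  qed
  with b \<open>b \<noteq> 0\<close> show ?thesis by (intro exI[of _ a]) auto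
qed

section \<open>Translation of the argument\<close>

definition shift :: "int \<Rightarrow> rat poly \<Rightarrow> rat poly" where
  "shift l p = p \<circ>\<^sub>p [:of_int l, 1:]"

lemma poly_shift: "poly (shift l p) x = poly p (x + of_int l)"
  by (simp add: shift_def poly_pcompose add.commute)

lemma int_value_shift: "int_value (shift l p) n = int_value p (n + l)"
  by (simp add: int_value_def poly_shift)

lemma int_valued_shift: "int_valued p \<Longrightarrow> int_valued (shift l p)"
  unfolding int_valued_def poly_shift by (metis of_int_add)

lemma degree_shift [simp]: "degree (shift l p) = degree p"
  by (simp add: shift_def degree_pcompose)

lemma lead_coeff_shift: "lead_coeff (shift l p) = lead_coeff p"
  unfolding shift_def by (subst lead_coeff_comp) auto

lemma shift_diff: "shift l (p - q) = shift l p - shift l q"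
  by (simp add: shift_def pcompose_diff)

lemma shift_shift: "shift l (shift m p) = shift (l + m) p"
  by (intro iffD1[OF poly_eq_poly_eq_iff] ext) (simp add: poly_shift ac_simps)

lemma degree_shift_diff_shift: "degree (shift l p - shift m q) = degree (shift (l - m) p - q)"
  using degree_shift[of m "shift (l - m) p - q"] by (simp add: shift_diff shift_shift)

lemma degree_eq_if_diff_constant:
  fixes p q :: "'a::ring_1 poly"
  assumes "degree (p - q) = 0" shows "degree p = degree q"
  by (metis assms bot_nat_0.not_eq_extremum degree_add_eq_right degree_diff_le diff_add_cancel
      le_0_eq less_or_eq_imp_le minus_diff_eq degree_minus diff_0_right max.idem)

text \<open>If \<open>p(x + m) - p(x) = c\<close>, then \<open>p(x) - (c/m) x\<close> is periodic, hence constant.\<close>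

lemma degree_le_1_if_shift_diff_constant:
  assumes m: "m \<noteq> 0" and "degree (shift m p - p) = 0"
  shows "degree p \<le> 1"
proof -
  obtain c where c: "shift m p - p = [:c:]" using assms(2) by (meson degree_eq_zeroE)
  define q where "q = p - [:0, c / of_int m:]"
  have per: "poly q (x + of_int m) = poly q x" for x
  proof -
    have "poly p (x + of_int m) - poly p x = c"
      using arg_cong[OF c, of "\<lambda>r. poly r x"] by (simp add: poly_shift)
    then show ?thesis using m by (simp add: q_def field_simps)
  qed
  have "poly q (of_nat k * of_int m) = poly q 0" for k :: nat
  proof (induction k)
    case (Suc k)
    then show ?case using per[of "of_nat k * of_int m"] by (simp add: algebra_simps)
  qed simp
  then have "range (\<lambda>k::nat. of_nat k * of_int m) \<subseteq> {x. poly (q - [:poly q 0:]) x = 0}" by auto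
  moreover have "infinite (range (\<lambda>k::nat. of_nat k * (of_int m :: rat)))"
    using m by (intro range_inj_infinite) (simp add: inj_def)
  ultimately have "q - [:poly q 0:] = 0"
    using poly_roots_finite finite_subset by blast
  then obtain e where "q = [:e:]" by auto
  moreover have "p = q + [:0, c / of_int m:]" by (simp add: q_def)
  ultimately show ?thesis by simp
qed

text \<open>At most one such \<open>m\<close> exists: for two of them \<open>q\<close> cancels and
  \<open>shift (m - m') p - p\<close> would be constant, which degree at least 2 forbids.\<close>

lemma finite_constant_shift_diff:
  assumes "degree p \<ge> 2"
  shows "finite {m. degree (shift m p - q) = 0}"
proof -
  have "m = m'" if "degree (shift m p - q) = 0" "degree (shift m' p - q) = 0" for m m'
  proof (rule ccontr)
    assume "m \<noteq> m'"
    have "degree ((shift m p - q) - (shift m' p - q)) \<le> 0"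
      using that by (metis degree_diff_le le_refl)
    then have "degree (shift (m - m') p - p) = 0"
      by (simp flip: degree_shift_diff_shift)
    then show False
      using degree_le_1_if_shift_diff_constant[of "m - m'" p] \<open>m \<noteq> m'\<close> assms by simp
  qed
  then show ?thesis by (metis (mono_tags, lifting) finite.simps is_singletonI' is_singleton_def mem_Collect_eq)
qed

text \<open>
  The weight of \<open>A\<close> records, for each degree, how many leading coefficients occur in that degree;
  multisets of degrees are compared by the largest degree on which they differ.
\<close>

definition pet_classes :: "rat poly set \<Rightarrow> (nat \<times> rat) set" where
  "pet_classes A = (\<lambda>p. (degree p, lead_coeff p)) ` A"

definition pet_weight :: "rat poly set \<Rightarrow> nat multiset" where
  "pet_weight A = image_mset fst (mset_set (pet_classes A))"

text \<open>Subtracting \<open>q\<close> preserves the degree of every class other than that of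
  \<open>q\<close> and keeps these classes apart, while the other members of the class of
  \<open>q\<close> drop below \<open>degree q\<close>. Thus one copy of \<open>degree q\<close> is
  traded for smaller degrees.\<close>

lemma pet_weight_decreases:
  assumes B: "finite B" "q \<in> B" and min: "\<And>p. p \<in> B \<Longrightarrow> degree q \<le> degree p"
    and pos: "degree q > 0"
  shows "(pet_weight ((\<lambda>p. p - q) ` (B - {q})), pet_weight B) \<in> mult less_than"
proof -
  define d c where "d = degree q" and "c = lead_coeff q"
  define cl where "cl = (\<lambda>p :: rat poly. (degree p, lead_coeff p))"
  define C where "C = pet_classes B - {(d, c)}"
  define f where "f = (\<lambda>(e, b). (e, if e = d then b - c else b) :: nat \<times> rat)"
  define D where "D = cl ` (\<lambda>p. p - q) ` {p \<in> B - {q}. cl p = (d, c)}"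
  have fin: "finite C" "finite D" using B by (auto simp: C_def D_def pet_classes_def)
  have other: "cl (p - q) = f (cl p)" if "p \<in> B" "cl p \<noteq> (d, c)" for p
  proof (cases "degree p = d")
    case True
    then have "coeff (p - q) d \<noteq> 0" using that(2) by (auto simp: cl_def d_def c_def)
    moreover have "degree (p - q) \<le> d" using True by (simp add: d_def degree_diff_le)
    ultimately have "degree (p - q) = d" by (simp add: le_antisym le_degree)
    then show ?thesis using True by (simp add: cl_def f_def d_def c_def)
  next
    case False
    then have "degree q < degree p" using min[OF that(1)] by (simp add: d_def)
    then have "degree (p - q) = degree p" "coeff q (degree p) = 0"
      using degree_add_eq_left[of "- q" p] by (simp_all add: coeff_eq_0)
    then show ?thesis using False by (simp add: cl_def f_def)
  qed
  have low: "degree (p - q) < d" if "cl p = (d, c)" for p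
  proof -
    have "degree (p - q) \<le> d" "coeff (p - q) d = 0"
      using that by (auto simp: cl_def d_def c_def intro: degree_diff_le)
    \<comment> \<open>In degree \<open>d\<close> the vanishing coefficient would be the leading one,
      so \<open>p - q\<close> would be 0, whose degree is not the positive \<open>d\<close>.\<close>
    moreover have "degree (p - q) \<noteq> d"
      using pos calculation(2) by (metis d_def degree_0 leading_coeff_0_iff less_irrefl)
    ultimately show ?thesis by simp
  qed
  have C: "C = cl ` {p \<in> B. cl p \<noteq> (d, c)}"
    unfolding C_def pet_classes_def cl_def by blast
  have split: "B - {q} = {p \<in> B. cl p \<noteq> (d, c)} \<union> {p \<in> B - {q}. cl p = (d, c)}"
    by (auto simp: cl_def d_def c_def)
  have "cl ` (\<lambda>p. p - q) ` {p \<in> B. cl p \<noteq> (d, c)} = f ` C"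
    unfolding C image_image using other by (intro image_cong) auto
  then have classes: "pet_classes ((\<lambda>p. p - q) ` (B - {q})) = f ` C \<union> D"
    unfolding pet_classes_def cl_def[symmetric] D_def by (subst split) (simp add: image_Un)
  have D_low: "fst z < d" if "z \<in> D" for z
    using that low by (auto simp: D_def cl_def)
  have C_high: "fst z \<ge> d" if "z \<in> C" for z
    using that min by (auto simp: C cl_def d_def)
  have disj: "f ` C \<inter> D = {}" using D_low C_high by (fastforce simp: f_def)
  have "inj_on f C" by (auto simp: inj_on_def f_def split: if_splits)
  then have "mset_set (f ` C) = image_mset f (mset_set C)" by (simp add: image_mset_mset_set)
  then have "image_mset fst (mset_set (f ` C)) = image_mset fst (mset_set C)"
    by (simp add: multiset.map_comp comp_def f_def case_prod_beta)
  then have 1: "pet_weight ((\<lambda>p. p - q) ` (B - {q}))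
      = image_mset fst (mset_set C) + image_mset fst (mset_set D)"
    unfolding pet_weight_def classes using fin disj by (simp add: mset_set_Union)
  have "pet_classes B = insert (d, c) C"
    using B(2) by (auto simp: C_def pet_classes_def d_def c_def)
  moreover have "(d, c) \<notin> C" by (simp add: C_def)
  ultimately have 2: "pet_weight B = image_mset fst (mset_set C) + {#d#}"
    unfolding pet_weight_def using fin by simp
  show ?thesis unfolding 1 2
    by (rule one_step_implies_mult) (use fin D_low in auto)
qed

section \<open>Polynomial recurrence\<close>

context weakly_mixing_minimal
begin

text \<open>The times \<open>l s\<close> are chosen one after another while the sets
  \<open>W i\<close> shrink. Each must serve all \<open>i\<close> at once, which is possible because
  dilated return time sets are thickly syndetic, and must avoid finitely many values to keep the
  differences out of \<open>M\<close>.\<close>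

lemma choose_shifts:
  assumes "finite F" "finite I" "finite M"
    and a: "\<And>i. i \<in> I \<Longrightarrow> a i \<noteq> 0"
    and V: "\<And>i. i \<in> I \<Longrightarrow> open (V i) \<and> V i \<noteq> {}"
  shows "\<exists>l W. (\<forall>i\<in>I. open (W i) \<and> W i \<noteq> {} \<and> W i \<subseteq> V i \<and>
                  (\<forall>s\<in>F. \<forall>x\<in>W i. it (a i * l s - s) x \<in> V i)) \<and>
               (\<forall>s\<in>F. \<forall>t\<in>F. s \<noteq> t \<longrightarrow> l s - l t \<notin> M)"
  using assms(1)
proof (induction rule: finite_induct)
  case empty
  show ?case using V by (intro exI[of _ "\<lambda>_. 0"] exI[of _ V]) auto
next
  case (insert s F)
  from insert.IH obtain l W where lW: "\<forall>i\<in>I. open (W i) \<and> W i \<noteq> {} \<and> W i \<subseteq> V i \<and>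
      (\<forall>s\<in>F. \<forall>x\<in>W i. it (a i * l s - s) x \<in> V i)"
    and l: "\<forall>s\<in>F. \<forall>t\<in>F. s \<noteq> t \<longrightarrow> l s - l t \<notin> M"
    by (elim exE conjE) (rule that)
  have W: "open (W i) \<and> W i \<noteq> {} \<and> W i \<subseteq> V i" if "i \<in> I" for i using lW that by simp
  \<comment> \<open>For \<open>k\<close> in \<open>?S\<close>, each \<open>it (a i * k)\<close>
    takes some point of \<open>W i\<close> into the translate of \<open>V i\<close> by
    \<open>it s\<close>; \<open>?E\<close> holds the values that put a difference with an earlier
    \<open>l t\<close> into \<open>M\<close>.\<close>
  let ?S = "\<Inter>i\<in>I. {k. a i * k \<in> returns (W i) (it (- s) -` V i)}"
  let ?E = "\<Union>t\<in>F. (\<lambda>m. l t + m) ` M \<union> (\<lambda>m. l t - m) ` M"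
  have "thickly_syndetic {k. a i * k \<in> returns (W i) (it (- s) -` V i)}" if "i \<in> I" for i
    using W[OF that] V[OF that]
    by (intro thickly_syndetic_dilation a[OF that] thickly_syndetic_returns open_vimage_it
        vimage_it_nonempty) simp_all
  then have "thickly_syndetic ?S" by (rule thickly_syndetic_INT[OF \<open>finite I\<close>])
  moreover have "finite ?E" using insert.hyps(1) \<open>finite M\<close> by simp
  ultimately have "\<exists>k\<in>?S. k \<notin> ?E" by (rule thickly_syndetic_not_subset_finite)
  then obtain k where k: "k \<in> ?S" "k \<notin> ?E" by (rule bexE) (rule that)
  define W' where "W' i = W i \<inter> it (a i * k - s) -` V i" for i
  have 1: "open (W' i)" "W' i \<noteq> {}" "W' i \<subseteq> V i" if i: "i \<in> I" for i
  proof -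
    show "open (W' i)" "W' i \<subseteq> V i" using W[OF that] V[OF that] by (auto simp: W'_def intro: open_vimage_it)
    obtain x where "x \<in> W i" "it (- s) (it (a i * k) x) \<in> V i"
    proof -
      have "a i * k \<in> returns (W i) (it (- s) -` V i)" using k(1) i by blast
      then show thesis using that by (auto simp: returns_def)
    qed
    then have "x \<in> W' i" by (simp add: W'_def flip: it_add)
    then show "W' i \<noteq> {}" by blast
  qed
  have 2: "it (a i * (l(s := k)) t - t) x \<in> V i" if "i \<in> I" "t \<in> insert s F" "x \<in> W' i" for i t x
    using that lW by (auto simp: W'_def)
  have 3: "(l(s := k)) t - (l(s := k)) t' \<notin> M" if "t \<in> insert s F" "t' \<in> insert s F" "t \<noteq> t'" for t t'
  proof -
    have "k - l t \<notin> M" "l t - k \<notin> M" if "t \<in> F" for t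
    proof -
      have "k \<notin> (\<lambda>m. l t + m) ` M" "k \<notin> (\<lambda>m. l t - m) ` M" using k(2) that by blast+
      then show "k - l t \<notin> M" "l t - k \<notin> M"
        using image_eqI[of k "\<lambda>m. l t + m" "k - l t" M] image_eqI[of k "\<lambda>m. l t - m" "l t - k" M]
        by auto
    qed
    then show ?thesis using that l by auto
  qed
  show ?case
    by (intro exI[of _ "l(s := k)"] exI[of _ W'] conjI ballI impI) (fact 1 | fact 2 | fact 3)+
qed

text \<open>The point \<open>x\<close> is unrestricted; a condition \<open>x \<in> U\<close> is
  expressed by including the polynomial 0.\<close>

definition recurrent :: "rat poly set \<Rightarrow> bool" where
  "recurrent B \<longleftrightarrow>
    (\<forall>V. (\<forall>p\<in>B. open (V p) \<and> V p \<noteq> {}) \<longrightarrow> (\<exists>n x. \<forall>p\<in>B. it (int_value p n) x \<in> V p))"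

text \<open>A solution \<open>x\<close> for the differences gives the solution
  \<open>it (- int_value q n) x\<close> for \<open>B\<close>, with the same
  \<open>n\<close>.\<close>

lemma recurrent_if_recurrent_diff:
  assumes "\<And>p. p \<in> B \<Longrightarrow> int_valued p" "int_valued q" "recurrent ((\<lambda>p. p - q) ` B)"
  shows "recurrent B"
  unfolding recurrent_def
proof (intro allI impI)
  fix V :: "rat poly \<Rightarrow> 'a set" assume V: "\<forall>p\<in>B. open (V p) \<and> V p \<noteq> {}"
  have "\<forall>r\<in>(\<lambda>p. p - q) ` B. open (V (r + q)) \<and> V (r + q) \<noteq> {}" using V by simp
  then have "\<exists>n x. \<forall>r\<in>(\<lambda>p. p - q) ` B. it (int_value r n) x \<in> V (r + q)"
    using spec[OF assms(3)[unfolded recurrent_def], of "\<lambda>r. V (r + q)"] by (rule mp[rotated])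
  then obtain n x where "\<forall>p\<in>B. it (int_value (p - q) n) x \<in> V p" by auto
  then have "\<forall>p\<in>B. it (int_value p n) (it (- int_value q n) x) \<in> V p"
    using assms(1,2) by (simp add: int_value_diff flip: it_add)
  then show "\<exists>n x. \<forall>p\<in>B. it (int_value p n) x \<in> V p" by blast
qed

text \<open>Distinctness modulo constants: it yields positive degrees once one member is subtracted
  from the others.\<close>

abbreviation essentially_distinct :: "rat poly set \<Rightarrow> bool" where
  "essentially_distinct \<equiv> pairwise (\<lambda>p q. degree (p - q) > 0)"

text \<open>
  Cover \<open>X\<close> by finitely many \<open>T\<^sup>s V\<^sub>0\<close>, \<open>s \<in> F\<close>. If \<open>T\<^bsup>p(n + l s) - s\<^esup> x \<in> V\<^sub>p\<close> for all \<open>p\<close> and \<open>s\<close>,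
  then for \<open>s\<close> with \<open>x \<in> T\<^sup>s V\<^sub>0\<close> the point \<open>T\<^bsup>-s\<^esup> x\<close> and the time \<open>n + l s\<close> are as required. For linear \<open>p\<close> the shifts \<open>p(n + l s)\<close> differ only by constants, which is why these \<open>p\<close>
  are handled by shrinking \<open>V\<^sub>p\<close> instead.
\<close>

lemma recurrent_insert_0:
  assumes "finite A" "\<And>p. p \<in> A \<Longrightarrow> int_valued p \<and> degree p > 0" "essentially_distinct A"
  shows "recurrent (insert 0 A)"
  using assms
proof (induction "pet_weight A" arbitrary: A rule: wf_induct_rule[OF wf_mult[OF wf_less_than]])
  case (1 A)
  note A = 1(2-4) and IH = 1(1)
  show ?case
  proof (cases "A = {}")
    case True
    then show ?thesis by (simp add: recurrent_def ex_in_conv)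
  next
    case False
    show ?thesis unfolding recurrent_def
    proof (intro allI impI)
      fix V :: "rat poly \<Rightarrow> 'a set" assume V: "\<forall>p\<in>insert 0 A. open (V p) \<and> V p \<noteq> {}"
      obtain F where F: "finite F" "\<And>x. \<exists>s\<in>F. it (- s) x \<in> V 0"
        using finite_translates_cover[of "V 0"] V by (metis insertI1)
      then have "F \<noteq> {}" by blast
      define L N where "L = {p \<in> A. degree p = 1}" and "N = {p \<in> A. degree p \<noteq> 1}"
      have LN: "A = L \<union> N" "finite L" "finite N" using A(1) by (auto simp: L_def N_def)
      have N2: "degree p \<ge> 2" if "p \<in> N" for p using that A(2)[of p] by (auto simp: N_def)
      \<comment> \<open>The differences of shifts at which two members of degree at least 2 would
        come to differ by a constant.\<close>
      define M where "M = (\<Union>p\<in>N. \<Union>p'\<in>N. {m. degree (shift m p - p') = 0})"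
      have "finite M" unfolding M_def using LN(3) N2 by (intro finite_UN_I finite_constant_shift_diff)
      have "\<forall>p\<in>L. \<exists>a. a \<noteq> 0 \<and> (\<forall>n m. int_value p (n + m) = int_value p n + a * m)"
        using A(2) by (intro ballI linear_int_value) (simp_all add: L_def)
      then obtain a where a: "\<And>p. p \<in> L \<Longrightarrow> a p \<noteq> 0"
        "\<And>p n m. p \<in> L \<Longrightarrow> int_value p (n + m) = int_value p n + a p * m"
        by metis
      have "\<exists>l W. (\<forall>i\<in>L. open (W i) \<and> W i \<noteq> {} \<and> W i \<subseteq> V i \<and>
                  (\<forall>s\<in>F. \<forall>x\<in>W i. it (a i * l s - s) x \<in> V i)) \<and>
               (\<forall>s\<in>F. \<forall>t\<in>F. s \<noteq> t \<longrightarrow> l s - l t \<notin> M)"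
        using a(1) V LN(1) by (intro choose_shifts F(1) LN(2) \<open>finite M\<close>) simp_all
      then obtain l W where W: "\<forall>p\<in>L. open (W p) \<and> W p \<noteq> {} \<and> W p \<subseteq> V p \<and>
          (\<forall>s\<in>F. \<forall>x\<in>W p. it (a p * l s - s) x \<in> V p)"
        and l: "\<forall>s\<in>F. \<forall>t\<in>F. s \<noteq> t \<longrightarrow> l s - l t \<notin> M"
        by (elim exE conjE) (rule that)
      \<comment> \<open>Each nonlinear member is replaced by its shifts by all \<open>l s\<close>;
        each linear one is kept once.\<close>
      define g where "g = (\<lambda>(p, s). shift (l s) p)"
      define B where "B = L \<union> g ` (N \<times> F)"
      have g_distinct: "degree (g z - g z') > 0" if z: "z \<in> N \<times> F" "z' \<in> N \<times> F" "z \<noteq> z'" for z z'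
      proof -
        obtain p s p' s' where [simp]: "z = (p, s)" "z' = (p', s')" by fastforce
        show ?thesis
        proof (cases "s = s'")
          case True
          then have "degree (p - p') > 0"
            using z A(3) LN(1) by (auto simp: pairwise_def)
          with True show ?thesis by (simp add: g_def flip: shift_diff)
        next
          case False
          then have "l s - l s' \<notin> M" using l z by auto
          then show ?thesis using z by (auto simp: g_def M_def degree_shift_diff_shift)
        qed
      qed
      have inj: "inj_on g (N \<times> F)"
        using g_distinct by (metis degree_0 diff_self inj_onI less_irrefl)
      have g_N: "degree (g z) \<ge> 2" "int_valued (g z)" if "z \<in> N \<times> F" for z
        using that N2 A(2) LN(1) by (auto simp: g_def int_valued_shift)
      have L1: "degree p = 1" "int_valued p" if "p \<in> L" for p
        using that A(2) by (auto simp: L_def)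
      have L_g: "degree (p - g z) > 0" "degree (g z - p) > 0" if "p \<in> L" "z \<in> N \<times> F" for p z
        using L1(1)[OF that(1)] g_N(1)[OF that(2)] degree_eq_if_diff_constant[of p "g z"]
          degree_eq_if_diff_constant[of "g z" p] by auto
      have B_distinct: "essentially_distinct B"
        unfolding B_def pairwise_def
      proof (intro ballI impI)
        fix r r' assume r: "r \<in> L \<union> g ` (N \<times> F)" "r' \<in> L \<union> g ` (N \<times> F)" "r \<noteq> r'"
        show "degree (r - r') > 0"
        proof (cases "r \<in> L"; cases "r' \<in> L")
          assume "r \<in> L" "r' \<in> L"
          then show ?thesis using A(3) r(3) LN(1) by (simp add: pairwise_def)
        qed (use r L_g g_distinct in \<open>blast+\<close>)
      qed
      have B: "finite B" using LN F(1) by (simp add: B_def)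
      have B_pos: "int_valued p \<and> degree p > 0" if "p \<in> B" for p
        using that L1[of p] g_N unfolding B_def by (elim UnE imageE) fastforce+
      have "B \<noteq> {}" using False LN(1) \<open>F \<noteq> {}\<close> by (auto simp: B_def)
      \<comment> \<open>Shifting preserves degree and leading coefficient, so passing to many shifts
        creates no new classes.\<close>
      have "pet_classes (g ` (N \<times> F)) = pet_classes N"
      proof -
        have "pet_classes (g ` (N \<times> F)) = (\<lambda>z. (degree (fst z), lead_coeff (fst z))) ` (N \<times> F)"
          unfolding pet_classes_def image_image g_def
          by (intro image_cong) (auto simp: lead_coeff_shift[unfolded degree_shift])
        also have "\<dots> = pet_classes (fst ` (N \<times> F))"
          by (simp only: pet_classes_def image_image)
        also have "fst ` (N \<times> F) = N" using \<open>F \<noteq> {}\<close> by simp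
        finally show ?thesis .
      qed
      then have same_weight: "pet_weight B = pet_weight A"
        by (simp add: pet_weight_def B_def LN(1) pet_classes_def image_Un)
      \<comment> \<open>Least degree is what makes subtraction of \<open>q\<close> lower the weight;
        \<open>q - q\<close> supplies the 0 in the induction hypothesis.\<close>
      obtain q where q: "q \<in> B" "\<And>p. p \<in> B \<Longrightarrow> degree q \<le> degree p"
        using \<open>B \<noteq> {}\<close> ex_has_least_nat[of "\<lambda>p. p \<in> B" _ degree] by blast
      define B' where "B' = (\<lambda>p. p - q) ` (B - {q})"
      have "recurrent (insert 0 B')"
      proof (rule IH)
        show "(pet_weight B', pet_weight A) \<in> mult less_than"
          unfolding B'_def same_weight[symmetric] using B B_pos q by (intro pet_weight_decreases) auto
        show "finite B'" using B by (simp add: B'_def)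
        show "int_valued p \<and> degree p > 0" if "p \<in> B'" for p
          using that B_pos B_distinct q(1) by (auto simp: B'_def pairwise_def int_valued_diff)
        show "essentially_distinct B'"
          using B_distinct by (auto simp: B'_def pairwise_def)
      qed
      moreover have "insert 0 B' = (\<lambda>p. p - q) ` B" using q(1) by (auto simp: B'_def)
      ultimately have rec: "recurrent B"
        using recurrent_if_recurrent_diff[of B q] B_pos q(1) by simp
      \<comment> \<open>The targets for \<open>B\<close> are the shrunken sets for linear members
        and translates of \<open>V p\<close> by \<open>it s\<close> for shifted ones; injectivity of
        \<open>g\<close> lets \<open>p\<close> and \<open>s\<close> be read off from
        \<open>r\<close>.\<close>
      define V' where "V' r = (if r \<in> L then W r
        else case inv_into (N \<times> F) g r of (p, s) \<Rightarrow> it (- s) -` V p)" for r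
      have V'_L: "V' r = W r" if "r \<in> L" for r using that by (simp add: V'_def)
      have V'_g: "V' (g (p, s)) = it (- s) -` V p" if "p \<in> N" "s \<in> F" for p s
      proof -
        have "g (p, s) \<notin> L" using L_g(1)[of "g (p, s)" "(p, s)"] that by auto
        moreover have "inv_into (N \<times> F) g (g (p, s)) = (p, s)"
          using inv_into_f_f[OF inj, of "(p, s)"] that by simp
        ultimately show ?thesis by (simp add: V'_def)
      qed
      have "open (V' r) \<and> V' r \<noteq> {}" if "r \<in> B" for r
        using that unfolding B_def
      proof (elim UnE imageE SigmaE)
        assume "r \<in> L"
        then show ?thesis using W V'_L by simp
      next
        fix z p s assume "r = g z" "z = (p, s)" "p \<in> N" "s \<in> F"
        then show ?thesis using V LN(1) V'_g by (simp add: open_vimage_it vimage_it_nonempty)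
      qed
      then obtain n x where nx: "\<And>r. r \<in> B \<Longrightarrow> it (int_value r n) x \<in> V' r"
        using rec unfolding recurrent_def by blast
      obtain s where s: "s \<in> F" "it (- s) x \<in> V 0" using F(2) by blast
      have "it (int_value p (n + l s)) (it (- s) x) \<in> V p" if p: "p \<in> insert 0 A" for p
      proof -
        consider "p = 0" | "p \<in> L" | "p \<in> N" using p LN(1) by blast
        then show ?thesis
        proof cases
          case 1
          then show ?thesis using s(2) by simp
        next
          case 2
          then have "it (int_value p n) x \<in> W p" using nx[of p] V'_L by (simp add: B_def)
          \<comment> \<open>The change of time by \<open>l s\<close> and of point by
            \<open>- s\<close> together contribute \<open>a p * l s - s\<close>, the power that
            takes \<open>W p\<close> into \<open>V p\<close>.\<close>
          then have "it (a p * l s - s) (it (int_value p n) x) \<in> V p" using W 2 s(1) by blast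
          then show ?thesis using a(2)[OF 2] by (simp add: algebra_simps flip: it_add)
        next
          case 3
          then have "it (int_value (g (p, s)) n) x \<in> it (- s) -` V p"
            using nx[of "g (p, s)"] V'_g s(1) by (auto simp: B_def)
          then show ?thesis
            by (simp add: g_def int_value_shift algebra_simps flip: it_add)
        qed
      qed
      then show "\<exists>n x. \<forall>p\<in>insert 0 A. it (int_value p n) x \<in> V p" by blast
    qed
  qed
qed

text \<open>Vanishing at 0 turns distinctness into distinctness modulo constants. The set
  \<open>U\<close> is assigned to the polynomial 0, which differs from every \<open>p i\<close> by
  positivity of degree.\<close>

lemma polynomial_recurrence:
  fixes p :: "'i \<Rightarrow> rat poly"
  assumes I: "finite I" "\<And>i. i \<in> I \<Longrightarrow> p i \<in> P0_star" "inj_on p I"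
    and U: "open U" "U \<noteq> {}" and V: "\<And>i. i \<in> I \<Longrightarrow> open (V i) \<and> V i \<noteq> {}"
  shows "\<exists>n. \<exists>x\<in>U. \<forall>i\<in>I. it (int_value (p i) n) x \<in> V i"
proof -
  have pos: "int_valued (p i) \<and> degree (p i) > 0" if "i \<in> I" for i
    using I(2)[OF that] by (simp add: P0_star_def int_valued_def)
  have "degree (p i - p j) > 0" if ij: "i \<in> I" "j \<in> I" "p i \<noteq> p j" for i j
  proof (rule ccontr)
    assume "\<not> degree (p i - p j) > 0"
    then obtain c where c: "p i - p j = [:c:]" by (auto elim: degree_eq_zeroE)
    have "poly (p i) 0 - poly (p j) 0 = poly (p i - p j) 0" by simp
    also have "\<dots> = c" unfolding c by simp
    finally have "c = poly (p i) 0 - poly (p j) 0" ..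
    then have "p i - p j = 0" using c I(2) ij by (simp add: P0_star_def)
    then show False using ij(3) by simp
  qed
  then have "essentially_distinct (p ` I)" by (auto simp: pairwise_def)
  then have rec: "recurrent (insert 0 (p ` I))"
    using I(1) pos by (intro recurrent_insert_0) auto
  define V' where "V' r = (if r = 0 then U else V (inv_into I p r))" for r
  have V'_p: "V' (p i) = V i" if "i \<in> I" for i
    using pos[OF that] that I(3) by (auto simp: V'_def)
  have "\<forall>r\<in>insert 0 (p ` I). open (V' r) \<and> V' r \<noteq> {}"
    using V'_p V U by (auto simp: V'_def[of 0])
  then obtain n x where nx: "\<forall>r\<in>insert 0 (p ` I). it (int_value r n) x \<in> V' r"
    using rec unfolding recurrent_def by blast
  then have "x \<in> U" by (simp add: V'_def[of 0])
  moreover have "\<forall>i\<in>I. it (int_value (p i) n) x \<in> V i" using nx V'_p by auto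
  ultimately show ?thesis by blast
qed

end

section \<open>Residual sets of points with dense orbits\<close>

lemma countable_Inter_gdelta:
  assumes "countable \<G>" "\<G> \<noteq> {}" "\<And>G. G \<in> \<G> \<Longrightarrow> open G"
  shows "gdelta (\<Inter>\<G>)"
proof -
  have "\<Inter>\<G> = \<Inter>(range (from_nat_into \<G>))"
    using assms by (simp add: range_from_nat_into)
  moreover have "gdelta \<dots>"
    by (rule gdelta.intros) (simp add: assms from_nat_into)
  ultimately show ?thesis by simp
qed

context weakly_mixing_minimal
begin

lemma closure_Inter_open_dense:
  fixes \<G> :: "'a set set"
  assumes "countable \<G>" "\<And>G. G \<in> \<G> \<Longrightarrow> open G \<and> closure G = UNIV"
  shows "closure (\<Inter>\<G>) = UNIV"
proof -
  have "compact_space (euclidean :: 'a topology)"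
    using compact_space by (simp add: compact_space_def)
  then have "locally_compact_space (euclidean :: 'a topology)"
    by (rule compact_imp_locally_compact_space)
  moreover have "regular_space (euclidean :: 'a topology)"
    by (simp add: metrizable_imp_regular_space metrizable_space_euclidean)
  ultimately have "euclidean closure_of (\<Inter>\<G>) = topspace (euclidean :: 'a topology)"
    using assms by (intro Baire_category disjI2 conjI) auto
  then show ?thesis by simp
qed

text \<open>\<open>G k f\<close> collects the points whose polynomial orbit enters a product of
  balls of radius \<open>1 / Suc k\<close>; it is open, and dense by polynomial recurrence. With
  centres in finite nets there are countably many such sets, and their intersection is
  \<open>X0\<close>.\<close>

lemma dense_polynomial_orbits:
  fixes p :: "nat \<Rightarrow> rat poly"
  assumes p: "\<And>i. i \<in> {1..d} \<Longrightarrow> p i \<in> P0_star" "inj_on p {1..d}"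
  shows "\<exists>X0 :: 'a set. gdelta X0 \<and> closure X0 = UNIV \<and>
    (\<forall>x\<in>X0. power_space d closure_of (range (\<lambda>n::int. \<lambda>i\<in>{1..d}. it (int_value (p i) n) x))
      = topspace (power_space d :: (nat \<Rightarrow> 'a) topology))"
proof -
  have "\<exists>E :: 'a set. finite E \<and> UNIV \<subseteq> (\<Union>e\<in>E. ball e (1 / Suc k))" for k
    by (rule compact_space[unfolded compact_eq_totally_bounded, THEN conjunct2, rule_format]) simp
  then have "\<forall>k. \<exists>E :: 'a set. finite E \<and> UNIV \<subseteq> (\<Union>e\<in>E. ball e (1 / Suc k))" by (rule allI)
  from choice[OF this] obtain E :: "nat \<Rightarrow> 'a set"
    where "\<forall>k. finite (E k) \<and> UNIV \<subseteq> (\<Union>e\<in>E k. ball e (1 / Suc k))" by (rule exE)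
  then have E: "finite (E k)" "UNIV \<subseteq> (\<Union>e\<in>E k. ball e (1 / Suc k))" for k by simp_all
  define G where "G k f = (\<Union>n. \<Inter>i\<in>{1..d}. it (int_value (p i) n) -` ball (f i) (1 / Suc k))"
    for k :: nat and f :: "nat \<Rightarrow> 'a"
  define \<G> where "\<G> = (\<Union>k. G k ` PiE {1..d} (\<lambda>_. E k))"
  have G: "open (G k f)" "closure (G k f) = UNIV" for k f
  proof -
    show "open (G k f)"
      unfolding G_def by (intro open_UN ballI open_INT open_vimage_it) auto
    have "G k f \<inter> U \<noteq> {}" if U: "open U" "U \<noteq> {}" for U
    proof -
      have "\<exists>n. \<exists>x\<in>U. \<forall>i\<in>{1..d}. it (int_value (p i) n) x \<in> ball (f i) (1 / Suc k)"
        using p U by (intro polynomial_recurrence) auto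
      then obtain n x where "x \<in> U" "\<forall>i\<in>{1..d}. it (int_value (p i) n) x \<in> ball (f i) (1 / Suc k)"
        by blast
      then have "x \<in> G k f \<inter> U" unfolding G_def by (intro IntI UN_I[of n] INT_I) auto
      then show ?thesis by blast
    qed
    then have dense: "open U \<Longrightarrow> U \<noteq> {} \<Longrightarrow> G k f \<inter> U \<noteq> {}" for U .
    show "closure (G k f) = UNIV"
    proof (rule ccontr)
      assume "closure (G k f) \<noteq> UNIV"
      then have "G k f \<inter> - closure (G k f) \<noteq> {}" by (intro dense) auto
      then show False using closure_subset[of "G k f"] by blast
    qed
  qed
  have "countable (G k ` PiE {1..d} (\<lambda>_. E k))" for k
    using E(1) by (intro countable_image countable_finite finite_PiE) auto
  then have "countable \<G>" unfolding \<G>_def by simp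
  have \<G>: "open H \<and> closure H = UNIV" if "H \<in> \<G>" for H
    using that G by (auto simp: \<G>_def)
  have "E 0 \<noteq> {}"
  proof
    assume "E 0 = {}"
    then show False using E(2)[of 0] by simp
  qed
  then have "PiE {1..d} (\<lambda>_. E 0) \<noteq> {}" by (simp add: PiE_eq_empty_iff)
  then have "\<G> \<noteq> {}" unfolding \<G>_def by blast
  have "power_space d closure_of (range (\<lambda>n::int. \<lambda>i\<in>{1..d}. it (int_value (p i) n) x))
      = topspace (power_space d)" if x: "x \<in> \<Inter>\<G>" for x
  proof -
    have meets: "\<exists>z. z \<in> range (\<lambda>n::int. \<lambda>i\<in>{1..d}. it (int_value (p i) n) x) \<and> z \<in> S"
      if y: "y \<in> S" and S: "openin (power_space d) S" for y S
    proof -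
      obtain U where U: "\<forall>i\<in>{1..d}. open (U i)" "y \<in> PiE {1..d} U" "PiE {1..d} U \<subseteq> S"
        using S[unfolded power_space_def openin_product_topology_alt, THEN bspec, OF y]
        unfolding open_openin[symmetric] by (elim exE conjE) (rule that)
      have "\<forall>i\<in>{1..d}. \<exists>e>0. ball (y i) e \<subseteq> U i"
      proof
        fix i assume "i \<in> {1..d}"
        then have "open (U i)" "y i \<in> U i" using U(1) PiE_mem[OF U(2)] by simp_all
        then show "\<exists>e>0. ball (y i) e \<subseteq> U i" by (simp add: open_contains_ball)
      qed
      from bchoice[OF this] obtain e where
        e: "\<forall>i\<in>{1..d}. e i > 0 \<and> ball (y i) (e i) \<subseteq> U i" by (rule exE)
      \<comment> \<open>The 1 keeps the minimum meaningful when \<open>d = 0\<close>.\<close>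
      define r where "r = Min (insert 1 (e ` {1..d}))"
      have "r > 0" using e by (simp add: r_def)
      have r_le: "r \<le> e i" if "i \<in> {1..d}" for i
        using that unfolding r_def by (intro Min_le) simp_all
      \<comment> \<open>Half of \<open>r\<close>, since the distances from the net point to
        \<open>y i\<close> and to the orbit point are each below \<open>1 / Suc k\<close>.\<close>
      obtain k where k: "1 / Suc k < r / 2"
        using \<open>r > 0\<close> by (rule nat_approx_posE[OF half_gt_zero])
      have "\<exists>c. c \<in> E k \<and> dist c (y i) < 1 / Suc k" for i
        using subsetD[OF E(2)[of k] UNIV_I[of "y i"]] by auto
      then have "\<forall>i. \<exists>c. c \<in> E k \<and> dist c (y i) < 1 / Suc k" by (rule allI)
      from choice[OF this] obtain f where f: "\<forall>i. f i \<in> E k \<and> dist (f i) (y i) < 1 / Suc k"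
        by (rule exE)
      have "restrict f {1..d} \<in> PiE {1..d} (\<lambda>_. E k)" using f by simp
      then have "G k (restrict f {1..d}) \<in> \<G>" unfolding \<G>_def by blast
      then have "x \<in> G k (restrict f {1..d})" using x by blast
      then obtain n where
        "\<forall>i\<in>{1..d}. it (int_value (p i) n) x \<in> ball (restrict f {1..d} i) (1 / Suc k)"
        unfolding G_def by blast
      then have n: "dist (f i) (it (int_value (p i) n) x) < 1 / Suc k" if "i \<in> {1..d}" for i
        using that by (auto dest: bspec[of _ _ i])
      have "it (int_value (p i) n) x \<in> U i" if i: "i \<in> {1..d}" for i
      proof -
        have "dist (y i) (it (int_value (p i) n) x) \<le> dist (f i) (y i) + dist (f i) (it (int_value (p i) n) x)"
          by (rule dist_triangle3)
        then have "dist (y i) (it (int_value (p i) n) x) < e i"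
          using spec[OF f, of i] n[OF i] k r_le[OF i] by linarith
        then show ?thesis using e i by (auto simp: subset_iff)
      qed
      then have "(\<lambda>i\<in>{1..d}. it (int_value (p i) n) x) \<in> S" using U(3) by auto
      then show ?thesis by blast
    qed
    show ?thesis
    proof (intro equalityI closure_of_subset_topspace subsetI)
      fix y :: "nat \<Rightarrow> 'a" assume "y \<in> topspace (power_space d)"
      then show "y \<in> power_space d closure_of (range (\<lambda>n::int. \<lambda>i\<in>{1..d}. it (int_value (p i) n) x))"
        unfolding in_closure_of by (intro conjI allI impI meets) auto
    qed
  qed
  moreover have "gdelta (\<Inter>\<G>)"
    using \<open>countable \<G>\<close> \<open>\<G> \<noteq> {}\<close> \<G> by (simp add: countable_Inter_gdelta)
  moreover have "closure (\<Inter>\<G>) = UNIV"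
    using \<open>countable \<G>\<close> \<G> by (rule closure_Inter_open_dense)
  ultimately show ?thesis by blast
qed

end

theorem theorem1p2:
  fixes T :: "'a::metric_space \<Rightarrow> 'a"
    and p :: "nat \<Rightarrow> rat poly"
    and d :: nat
  assumes compact_X: "compact (UNIV :: 'a set)"
    and homeo: "\<exists>S. homeomorphism UNIV UNIV T S"
    and minimal: "minimal_system T"
    and weakly_mixing: "weakly_mixing_system T"
    and polys: "\<And>i. i \<in> {1..d} \<Longrightarrow> p i \<in> P0_star"
    and distinct: "inj_on p {1..d}"
  shows "\<exists>X0 :: 'a set. gdelta X0 \<and> closure X0 = UNIV \<and>
    (\<forall>x\<in>X0. power_space d closure_of
        (range (\<lambda>n::int. \<lambda>i\<in>{1..d}. int_iterate T (int_value (p i) n) x))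
      = topspace (power_space d :: (nat \<Rightarrow> 'a) topology))"
proof -
  interpret weakly_mixing_minimal T
    using compact_X homeo minimal weakly_mixing by unfold_locales
  show ?thesis using polys distinct by (rule dense_polynomial_orbits)
qed

end
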